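(* There is a universal constant $c > 0$ such that for every integer $n \geq 1$, with $d = n$ and $B = \sqrt{n}$, the following hold. (a) If $p \in (0,1]$ and $\sigma = R = 1$, then $$\sup_{X \in \mathcal{X}_{n,d}(B)} \ \sup_{\|\theta^\star\|_p \leq R} \mathbf{E}\left[ \inf_{\lambda > 0} \left\| \hat\theta_\lambda(X,y) - \theta^\star \right\|_2^2 \right] \geq c.$$ (b) If $p = 0$ and $\sigma = s = 1$, then $$\sup_{X \in \mathcal{X}_{n,d}(B)} \ \sup_{\|\theta^\star\|_0 \leq s} \mathbf{E}\left[ \inf_{\lambda > 0} \left\| \hat\theta_\lambda(X,y) - \theta^\star \right\|_2^2 \right] \geq c.$$
   Context: For $\theta \in \mathbb{R}^d$ and $p \in (0,1]$, $\|\theta\|_p = \left(\sum_{i=1}^d |\theta_i|^p\right)^{1/p}$, and $\|\theta\|_0$ is the number of nonzero coordinates of $\theta$. The class of design matrices is $\mathcal{X}_{n,d}(B) = \left\{ X \in \mathbb{R}^{n\times d} : \tfrac{1}{n} X^{T} X \succeq \tfrac{1}{B} I_d \right\}$, where $\succeq$ is the positive semidefinite order. Expectations are over $y \sim \mathsf{N}(X\theta^\star, \sigma^2 I_n)$ with $\theta^\star \in \mathbb{R}^d$. For $\lambda > 0$ the Lasso estimator is $$\hat\theta_\lambda(X,y) = \operatorname*{arg\,min}_{\vartheta \in \mathbb{R}^d} \left\{ \tfrac{1}{n} \|X\vartheta - y\|_2^2 + 2\lambda \|\vartheta\|_1 \right\}.$$ The infimum over $\lambda$ is inside the expectation, so $\lambda$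 may depend on $y$, $X$ and $\theta^\star$. "Universal" means not depending on $n$ or $p$. *)

theory Defs
  imports "HOL-Probability.Probability" "Jordan_Normal_Form.Matrix"
begin

unbundle no inner_syntax and no vec_syntax

definition p_norm :: "real \<Rightarrow> real vec \<Rightarrow> real" where
  "p_norm p v = (\<Sum>i<dim_vec v. \<bar>v $ i\<bar> powr p) powr (1 / p)"

definition l0_norm :: "real vec \<Rightarrow> nat" where
  "l0_norm v = card {i. i < dim_vec v \<and> v $ i \<noteq> 0}"

definition sq_l2_norm :: "real vec \<Rightarrow> real" where
  "sq_l2_norm v = (\<Sum>i<dim_vec v. (v $ i)\<^sup>2)"

definition positive_semidefinite :: "nat \<Rightarrow> real mat \<Rightarrow> bool" where
  "positive_semidefinite d A \<longleftrightarrow>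
     A \<in> carrier_mat d d \<and> transpose_mat A = A \<and>
     (\<forall>v \<in> carrier_vec d. 0 \<le> v \<bullet> (A *\<^sub>v v))"

definition design_class :: "nat \<Rightarrow> nat \<Rightarrow> real \<Rightarrow> real mat set" where
  "design_class n d B =
     {X \<in> carrier_mat n d.
        positive_semidefinite d
          ((1 / real n) \<cdot>\<^sub>m (transpose_mat X * X) - (1 / B) \<cdot>\<^sub>m 1\<^sub>m d)}"

text \<open>For \<open>X\<close> in \<open>design_class n d B\<close> with \<open>n, B > 0\<close> the objective is continuous, coercive and
  strictly convex for every \<open>l > 0\<close>, so that the minimiser exists and is unique and the choice
  made by \<^const>\<open>arg_min_on\<close> is forced.\<close>

definition lasso :: "real mat \<Rightarrow> real vec \<Rightarrow> real \<Rightarrow> real vec" where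
  "lasso X y l =
     arg_min_on
       (\<lambda>\<theta>. (1 / real (dim_row X)) * sq_l2_norm (X *\<^sub>v \<theta> - y) + 2 * l * p_norm 1 \<theta>)
       (carrier_vec (dim_col X))"

text \<open>The law \<open>N(\<mu>, \<sigma>\<^sup>2 I)\<close> on \<open>\<real>\<^sup>n\<close>, \<open>n = dim_vec \<mu>\<close>, is the product of its one-dimensional
  marginals. Its sample points are functions on \<open>{..<n}\<close>; the function \<open>\<omega>\<close> stands for the vector
  \<open>vec n \<omega>\<close>.\<close>

definition normal_vec :: "real vec \<Rightarrow> real \<Rightarrow> (nat \<Rightarrow> real) measure" where
  "normal_vec \<mu> \<sigma> =
     (\<Pi>\<^sub>M i\<in>{..<dim_vec \<mu>}. density lborel (\<lambda>x. ennreal (normal_density (\<mu> $ i) \<sigma> x)))"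

text \<open>The infimum over \<open>l\<close> is taken inside the expectation. The integrand is nonnegative, so the
  expectation is a Lebesgue integral in \<open>[0, \<infinity>]\<close>. Where \<^const>\<open>lasso\<close> is the unique minimiser it is
  continuous in \<open>(y, l)\<close>, so the infimum can be taken over rational \<open>l\<close> and is measurable
  in \<open>\<omega>\<close>.\<close>

definition lasso_oracle_risk :: "real mat \<Rightarrow> real vec \<Rightarrow> real \<Rightarrow> ennreal" where
  "lasso_oracle_risk X \<theta> \<sigma> =
     (\<integral>\<^sup>+ \<omega>. (INF l\<in>{0<..}. ennreal (sq_l2_norm (lasso X (vec (dim_row X) \<omega>) l - \<theta>)))
        \<partial>normal_vec (X *\<^sub>v \<theta>) \<sigma>)"

definition p_ball :: "nat \<Rightarrow> real \<Rightarrow> real \<Rightarrow> real vec set" where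
  "p_ball d p R = {\<theta> \<in> carrier_vec d. p_norm p \<theta> \<le> R}"

definition l0_ball :: "nat \<Rightarrow> nat \<Rightarrow> real vec set" where
  "l0_ball d s = {\<theta> \<in> carrier_vec d. l0_norm \<theta> \<le> s}"

end

theory Submission
  imports Defs
begin

text \<open>
  A single diagonal design and a single target defeat every choice of the regularisation
  parameter. Let \<open>X\<close> have the diagonal \<open>(n\<^bsup>1/4\<^esup>, \<surd>n, \<dots>, \<surd>n)\<close> and let \<open>\<theta>\<close> be the first unit
  vector \<open>e\<^sub>0\<close>. The first column is as weak as \<open>B = \<surd>n\<close> permits, the others are
  well conditioned, and \<open>e\<^sub>0\<close> lies in all the balls of the theorem.

  For a diagonal design \<open>diag a\<close> the Lasso objective splits into one-dimensional problems, and the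
  estimate of coordinate \<open>i\<close> is the least squares value \<open>y\<^sub>i / a\<^sub>i\<close> soft thresholded at
  \<open>n l / a\<^sub>i\<^sup>2\<close> (lemma \<open>lasso_mat_diag\<close>). Here the threshold is \<open>\<surd>n l\<close> in coordinate \<open>0\<close> and
  \<open>l\<close> in the others, which gives two regimes.
  \<^item> If \<open>\<surd>n l \<ge> 1\<close>, the signal is thresholded away as soon as the noise in coordinate \<open>0\<close> is
    nonpositive, and the squared error is at least \<open>1\<close>: the bias is too large.
  \<^item> If \<open>\<surd>n l < 1\<close>, every coordinate whose noise is at most \<open>-2\<close> has a squared error of at least
    \<open>1/n\<close>: the threshold is too small for the noise of the well-conditioned coordinates, which is
    of size \<open>1/\<surd>n\<close>, and there are \<open>n\<close> of them.

  Hence, whenever the noise in coordinate \<open>0\<close> is at most \<open>-2\<close>, the loss is for all \<open>l\<close>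
  simultaneously at least the fraction of coordinates with noise at most \<open>-2\<close> (lemma
  \<open>hard_instance_loss\<close>). By independence each coordinate contributes with probability at least
  \<open>P(N(0,1) \<le> -2)\<^sup>2\<close>, so linearity of the expectation bounds the oracle risk from below by this
  constant. Coordinate \<open>0\<close> is
  itself among those counted, which makes the same argument work for \<open>n = 1\<close>.
\<close>

section \<open>Soft thresholding solves the Lasso for a diagonal design\<close>

definition soft :: "real \<Rightarrow> real \<Rightarrow> real" where
  "soft t z = (if z > t then z - t else if z < - t then z + t else 0)"

text \<open>The quadratic slack \<open>(x - soft t z)\<^sup>2\<close>, which comes from strong convexity of the objective,
  gives minimality and uniqueness at once. The inequality amounts to \<open>z - soft t z\<close> being a
  subgradient of \<open>t * \<bar>x\<bar>\<close> at \<open>soft t z\<close>.\<close>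

lemma soft_strong_minimality:
  assumes "t \<ge> 0"
  shows "(soft t z - z)\<^sup>2 + 2 * t * \<bar>soft t z\<bar> + (x - soft t z)\<^sup>2 \<le> (x - z)\<^sup>2 + 2 * t * \<bar>x\<bar>"
proof -
  let ?s = "soft t z"
  consider "z > t" | "z < - t" | "\<bar>z\<bar> \<le> t" by linarith
  then have "(x - ?s) * (z - ?s) + t * \<bar>?s\<bar> \<le> t * \<bar>x\<bar>"
  proof cases
    case 1
    then have s: "?s = z - t" "\<bar>z - t\<bar> = z - t" using assms by (auto simp: soft_def)
    have "t * x \<le> t * \<bar>x\<bar>" using assms by (intro mult_left_mono) auto
    then show ?thesis unfolding s by (simp add: algebra_simps)
  next
    case 2
    then have s: "?s = z + t" "\<bar>z + t\<bar> = - (z + t)" using assms by (auto simp: soft_def)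
    have "t * (- x) \<le> t * \<bar>x\<bar>" using assms by (intro mult_left_mono) auto
    then show ?thesis unfolding s by (simp add: algebra_simps)
  next
    case 3
    then have "?s = 0" by (auto simp: soft_def)
    moreover have "x * z \<le> \<bar>x\<bar> * \<bar>z\<bar>" by (metis abs_ge_self abs_mult)
    moreover have "\<bar>x\<bar> * \<bar>z\<bar> \<le> \<bar>x\<bar> * t" using 3 by (intro mult_left_mono) auto
    ultimately show ?thesis by (simp add: algebra_simps)
  qed
  then show ?thesis by (simp add: power2_eq_square algebra_simps)
qed

lemma mat_diag_mult_vec:
  assumes "v \<in> carrier_vec n"
  shows "mat_diag n a *\<^sub>v v = vec n (\<lambda>i. a i * v $ i)"
proof (rule eq_vecI)
  fix i assume "i < dim_vec (vec n (\<lambda>i. a i * v $ i))"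
  then have i: "i < n" by simp
  have "(mat_diag n a *\<^sub>v v) $ i = (\<Sum>j\<in>{0..<n}. (if i = j then a j else 0) * v $ j)"
    using assms i by (auto simp: scalar_prod_def mat_diag_def intro!: sum.cong)
  also have "\<dots> = (\<Sum>j\<in>{0..<n}. if i = j then a j * v $ j else 0)"
    by (intro sum.cong) auto
  also have "\<dots> = a i * v $ i" using i by simp
  finally show "(mat_diag n a *\<^sub>v v) $ i = vec n (\<lambda>i. a i * v $ i) $ i" using i by simp
qed (simp add: mat_diag_def)

text \<open>With \<open>w\<^sub>i = a\<^sub>i\<^sup>2 / n\<close> the objective is the \<open>w\<close>-weighted sum of the one-dimensional objectives
  \<open>(x - z\<^sub>i)\<^sup>2 + 2 t\<^sub>i \<bar>x\<bar>\<close>, \<open>z\<^sub>i = y\<^sub>i / a\<^sub>i\<close> and \<open>t\<^sub>i = n l / a\<^sub>i\<^sup>2\<close>. Soft thresholding minimises each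
  of them uniquely, and uniqueness determines the value that \<^const>\<open>arg_min_on\<close> selects.\<close>

lemma lasso_mat_diag:
  assumes "n \<ge> 1" and a: "\<And>i. i < n \<Longrightarrow> a i > 0" and "l \<ge> 0"
  shows "lasso (mat_diag n a) (vec n y) l = vec n (\<lambda>i. soft (real n * l / (a i)\<^sup>2) (y i / a i))"
    (is "_ = ?m")
proof -
  define t z w where "t i = real n * l / (a i)\<^sup>2" and "z i = y i / a i" and "w i = (a i)\<^sup>2 / real n"
    for i
  define f where "f \<theta> = (1 / real n) * sq_l2_norm (mat_diag n a *\<^sub>v \<theta> - vec n y) + 2 * l * p_norm 1 \<theta>"
    for \<theta>
  have m: "?m = vec n (\<lambda>i. soft (t i) (z i))" by (simp add: t_def z_def)
  have f_eq: "f \<theta> = (\<Sum>i<n. w i * ((\<theta> $ i - z i)\<^sup>2 + 2 * t i * \<bar>\<theta> $ i\<bar>))" if "\<theta> \<in> carrier_vec n" for \<theta>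
  proof -
    have "f \<theta> = (1 / real n) * (\<Sum>i<n. (a i * \<theta> $ i - y i)\<^sup>2) + 2 * l * (\<Sum>i<n. \<bar>\<theta> $ i\<bar>)"
      using that by (simp add: f_def sq_l2_norm_def p_norm_def mat_diag_mult_vec sum_nonneg)
    also have "\<dots> = (\<Sum>i<n. (a i * \<theta> $ i - y i)\<^sup>2 / real n + 2 * l * \<bar>\<theta> $ i\<bar>)"
      by (simp add: sum.distrib sum_distrib_left)
    also have "\<dots> = (\<Sum>i<n. w i * ((\<theta> $ i - z i)\<^sup>2 + 2 * t i * \<bar>\<theta> $ i\<bar>))"
    proof (intro sum.cong refl)
      fix i assume "i \<in> {..<n}"
      then have "a i > 0" using a by simp
      then have fit: "(a i * \<theta> $ i - y i)\<^sup>2 / real n = w i * (\<theta> $ i - z i)\<^sup>2" and l: "l = w i * t i"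
        using \<open>n \<ge> 1\<close> by (simp_all add: z_def w_def t_def field_simps power2_eq_square)
      show "(a i * \<theta> $ i - y i)\<^sup>2 / real n + 2 * l * \<bar>\<theta> $ i\<bar> =
          w i * ((\<theta> $ i - z i)\<^sup>2 + 2 * t i * \<bar>\<theta> $ i\<bar>)"
        unfolding fit l by (simp add: algebra_simps)
    qed
    finally show ?thesis .
  qed
  have w: "w i > 0" if "i < n" for i using a[OF that] \<open>n \<ge> 1\<close> by (simp add: w_def)
  have gap: "f ?m + (\<Sum>i<n. w i * (\<theta> $ i - ?m $ i)\<^sup>2) \<le> f \<theta>" if "\<theta> \<in> carrier_vec n" for \<theta>
  proof -
    have "f ?m + (\<Sum>i<n. w i * (\<theta> $ i - ?m $ i)\<^sup>2)
        = (\<Sum>i<n. w i * ((soft (t i) (z i) - z i)\<^sup>2 + 2 * t i * \<bar>soft (t i) (z i)\<bar>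
             + (\<theta> $ i - soft (t i) (z i))\<^sup>2))"
      by (simp add: f_eq m sum.distrib distrib_left)
    also have "\<dots> \<le> f \<theta>"
      unfolding f_eq[OF that]
    proof (intro sum_mono mult_left_mono soft_strong_minimality)
      fix i assume "i \<in> {..<n}"
      then show "0 \<le> w i" using w by (auto intro: less_imp_le)
      show "0 \<le> t i" using \<open>l \<ge> 0\<close> by (simp add: t_def)
    qed
    finally show ?thesis .
  qed
  have sq_nonneg: "0 \<le> (\<Sum>i<n. w i * (\<theta> $ i - ?m $ i)\<^sup>2)" for \<theta>
    using w by (intro sum_nonneg) (simp add: less_imp_le)
  have "is_arg_min f (\<lambda>\<theta>. \<theta> \<in> carrier_vec n) ?m"
    unfolding is_arg_min_linorder using gap sq_nonneg by (smt (verit) vec_carrier)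
  moreover have "\<theta> = ?m" if "is_arg_min f (\<lambda>\<theta>. \<theta> \<in> carrier_vec n) \<theta>" for \<theta>
  proof -
    have \<theta>: "\<theta> \<in> carrier_vec n" and "f \<theta> \<le> f ?m"
      using that unfolding is_arg_min_linorder by auto
    then have "(\<Sum>i<n. w i * (\<theta> $ i - ?m $ i)\<^sup>2) = 0"
      using gap[OF \<theta>] sq_nonneg[of \<theta>] by linarith
    then have "\<forall>i\<in>{..<n}. w i * (\<theta> $ i - ?m $ i)\<^sup>2 = 0"
      using w by (subst (asm) sum_nonneg_eq_0_iff) (auto simp: less_imp_le)
    then have "\<theta> $ i = ?m $ i" if "i < n" for i
      using w[OF that] that by force
    then show ?thesis using \<theta> by (intro eq_vecI) auto
  qed
  ultimately have "arg_min_on f (carrier_vec n) = ?m"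
    unfolding arg_min_on_def arg_min_def by (rule some_equality)
  then show ?thesis by (simp add: lasso_def f_def[abs_def] mat_diag_def)
qed

section \<open>Gaussian tails\<close>

definition gauss_tail :: real where
  "gauss_tail = measure (density lborel (\<lambda>x. ennreal (normal_density 0 1 x))) {..-2}"

lemma gauss_tail_bounds: "0 < gauss_tail" "gauss_tail \<le> 1"
proof -
  interpret prob_space "density lborel (\<lambda>x. ennreal (normal_density 0 1 x))"
    by (rule prob_space_normal_density) simp
  show "gauss_tail \<le> 1" unfolding gauss_tail_def by (rule prob_le_1)
  have "\<not> {..-2::real} \<in> null_sets lborel"
  proof
    assume "{..-2::real} \<in> null_sets lborel"
    then have "{-3..-2::real} \<in> null_sets lborel" by (rule null_sets_subset) auto
    then show False by (simp add: null_sets_def)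
  qed
  moreover have "{..-2::real} \<in> null_sets lborel"
    if "{..-2::real} \<in> null_sets (density lborel (\<lambda>x. ennreal (normal_density 0 1 x)))"
  proof -
    have "AE x in lborel. x \<in> {..-2::real} \<longrightarrow> ennreal (normal_density 0 1 x) = 0"
      using that by (subst (asm) null_sets_density_iff) auto
    moreover have "ennreal (normal_density 0 1 x) \<noteq> 0" for x :: real
      using normal_density_pos[of 1 0 x] by (simp add: ennreal_eq_0_iff not_le)
    ultimately have "AE x in lborel. \<not> x \<in> {..-2::real}" by simp
    then show ?thesis by (subst AE_iff_null_sets) auto
  qed
  ultimately have "emeasure (density lborel (\<lambda>x. ennreal (normal_density 0 1 x))) {..-2} \<noteq> 0"
    by (auto simp: null_sets_def)
  then show "0 < gauss_tail" unfolding gauss_tail_def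
    by (simp add: emeasure_eq_measure zero_less_measure_iff)
qed

lemma emeasure_normal_lower_tail:
  "emeasure (density lborel (\<lambda>x. ennreal (normal_density \<mu> 1 x))) {..\<mu> - 2} = ennreal gauss_tail"
proof -
  interpret prob_space "density lborel (\<lambda>x. ennreal (normal_density 0 1 x))"
    by (rule prob_space_normal_density) simp
  have "emeasure (density lborel (\<lambda>x. ennreal (normal_density \<mu> 1 x))) {..\<mu> - 2}
      = (\<integral>\<^sup>+x. ennreal (normal_density \<mu> 1 x) * indicator {..\<mu> - 2} x \<partial>lborel)"
    by (subst emeasure_density) auto
  also have "\<dots> = (\<integral>\<^sup>+x. ennreal (normal_density \<mu> 1 (\<mu> + 1 * x)) * indicator {..\<mu> - 2} (\<mu> + 1 * x) \<partial>lborel)"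
    by (subst nn_integral_real_affine[where c = 1 and t = \<mu>]) auto
  also have "\<dots> = (\<integral>\<^sup>+x. ennreal (normal_density 0 1 x) * indicator {..-2} x \<partial>lborel)"
    by (intro nn_integral_cong) (auto simp: normal_density_def indicator_def)
  also have "\<dots> = ennreal gauss_tail"
    unfolding gauss_tail_def by (subst emeasure_eq_measure[symmetric], subst emeasure_density) auto
  finally show ?thesis .
qed

lemma space_normal_vec: "space (normal_vec \<mu> \<sigma>) = {..<dim_vec \<mu>} \<rightarrow>\<^sub>E UNIV"
  by (simp add: normal_vec_def space_PiM)

text \<open>Allowing \<open>i = j\<close> is what lets coordinate \<open>0\<close> be counted along with the others. In that case
  the probability is the first power of \<^const>\<open>gauss_tail\<close>, which exceeds its square.\<close>

lemma normal_vec_joint_tail: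
  assumes "i < dim_vec \<mu>" "j < dim_vec \<mu>"
  defines "A \<equiv> {\<omega> \<in> space (normal_vec \<mu> 1). \<omega> i \<le> \<mu> $ i - 2 \<and> \<omega> j \<le> \<mu> $ j - 2}"
  shows "A \<in> sets (normal_vec \<mu> 1)" "emeasure (normal_vec \<mu> 1) A \<ge> ennreal (gauss_tail\<^sup>2)"
proof -
  let ?N = "\<lambda>k. density lborel (\<lambda>x. ennreal (normal_density (\<mu> $ k) 1 x))"
  let ?E = "\<lambda>k. if k \<in> {i, j} then {..\<mu> $ k - 2} else UNIV"
  let ?I = "{..<dim_vec \<mu>}"
  have prob: "prob_space (?N k)" for k by (rule prob_space_normal_density) simp
  interpret product_prob_space ?N
    by (rule product_prob_spaceI[OF prob])
  have E: "x \<in> ?E k \<longleftrightarrow> (k \<in> {i, j} \<longrightarrow> x \<le> \<mu> $ k - 2)" for x :: real and k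
    by auto
  have A_eq: "A = Pi\<^sub>E ?I ?E"
    unfolding A_def space_normal_vec set_eq_iff mem_Collect_eq PiE_iff E using assms(1,2) by blast
  show "A \<in> sets (normal_vec \<mu> 1)"
    unfolding A_eq normal_vec_def by (rule sets_PiM_I_finite) simp_all
  have "emeasure (normal_vec \<mu> 1) A = (\<Prod>k\<in>?I. emeasure (?N k) (?E k))"
    unfolding A_eq normal_vec_def by (rule emeasure_PiM) simp_all
  also have "\<dots> = (\<Prod>k\<in>?I. if k \<in> {i, j} then ennreal gauss_tail else 1)"
    using prob_space.emeasure_space_1[OF prob]
    by (intro prod.cong) (auto simp: emeasure_normal_lower_tail)
  also have "\<dots> = ennreal gauss_tail ^ card {i, j}"
    using assms(1,2) by (subst prod.inter_restrict[symmetric, where g = "\<lambda>_. ennreal gauss_tail"])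
      (auto intro!: arg_cong[where f = "\<lambda>S. ennreal gauss_tail ^ card S"])
  also have "\<dots> = ennreal (gauss_tail ^ card {i, j})"
    using gauss_tail_bounds by (simp add: ennreal_power)
  also have "\<dots> \<ge> ennreal (gauss_tail\<^sup>2)"
    using gauss_tail_bounds by (intro ennreal_leI power_decreasing) (auto simp: card_insert_if)
  finally show "emeasure (normal_vec \<mu> 1) A \<ge> ennreal (gauss_tail\<^sup>2)" .
qed

section \<open>The hard instance\<close>

text \<open>The diagonal of the design. The smallest admissible entry is \<open>n\<^bsup>1/4\<^esup>\<close>; putting it at the
  coordinate of the signal makes the bias there larger by the factor \<open>\<surd>n\<close> than the threshold
  which the other coordinates see.\<close>

definition hard_scale :: "nat \<Rightarrow> nat \<Rightarrow> real" where
  "hard_scale n i = (if i = 0 then sqrt (sqrt (real n)) else sqrt (real n))"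

lemma hard_design_in_class:
  assumes "n \<ge> 1"
  shows "mat_diag n (hard_scale n) \<in> design_class n n (sqrt (real n))"
proof -
  let ?X = "mat_diag n (hard_scale n)"
  define g where "g i = (hard_scale n i)\<^sup>2 / real n - 1 / sqrt (real n)" for i
  have T: "transpose_mat (mat_diag n h) = mat_diag n h" for h :: "nat \<Rightarrow> real"
    by (intro eq_matI) (auto simp: mat_diag_def)
  have X: "(1 / real n) \<cdot>\<^sub>m (transpose_mat ?X * ?X) - (1 / sqrt (real n)) \<cdot>\<^sub>m 1\<^sub>m n = mat_diag n g"
    unfolding T mat_diag_diag
    by (intro eq_matI) (auto simp: mat_diag_def g_def power2_eq_square)
  have g: "g i \<ge> 0" for i
  proof -
    have "1 / sqrt (real n) \<le> 1" "sqrt (real n) / real n = 1 / sqrt (real n)"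
      using assms by (auto simp: real_div_sqrt field_simps)
    then show ?thesis using assms by (simp add: g_def hard_scale_def)
  qed
  have "0 \<le> v \<bullet> (mat_diag n g *\<^sub>v v)" if "v \<in> carrier_vec n" for v
  proof -
    have "v \<bullet> (mat_diag n g *\<^sub>v v) = (\<Sum>i\<in>{0..<n}. g i * (v $ i)\<^sup>2)"
      using that by (simp add: mat_diag_mult_vec scalar_prod_def power2_eq_square algebra_simps)
    then show ?thesis using g by (simp add: sum_nonneg)
  qed
  then have "positive_semidefinite n (mat_diag n g)"
    unfolding positive_semidefinite_def by (auto simp: T)
  then show ?thesis unfolding design_class_def by (simp add: X)
qed

text \<open>The left side does not depend on \<open>l\<close>, so that this also bounds the loss of an oracle that
  chooses \<open>l\<close> after seeing \<open>y\<close> and the target. The two regimes meet at \<open>l = 1 / \<surd>n\<close>, where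
  the threshold of the signal coordinate equals the signal and that of the other coordinates is
  half of the deviation \<open>2 / \<surd>n\<close> of their least squares value.\<close>

lemma hard_instance_loss:
  assumes "n \<ge> 1" "l > 0"
  defines "\<mu> \<equiv> mat_diag n (hard_scale n) *\<^sub>v unit_vec n 0"
  assumes y0: "y 0 \<le> \<mu> $ 0 - 2"
  shows "real (card {i. i < n \<and> y i \<le> \<mu> $ i - 2}) / real n
    \<le> sq_l2_norm (lasso (mat_diag n (hard_scale n)) (vec n y) l - unit_vec n 0)"
proof -
  define r where "r = sqrt (real n)"
  define q where "q = sqrt r"
  have r: "r \<ge> 1" "r * r = real n" using assms(1) by (auto simp: r_def)
  then have q: "q \<ge> 1" "q * q = r" by (auto simp: q_def)
  have "q * 1 \<le> q * q" using q(1) by (intro mult_left_mono) auto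
  then have "q \<le> r" using q(2) by simp
  have scale: "hard_scale n i = (if i = 0 then q else r)" for i
    by (simp add: hard_scale_def q_def r_def)
  have \<mu>: "\<mu> $ i = (if i = 0 then q else 0)" if "i < n" for i
    using that by (simp add: \<mu>_def mat_diag_mult_vec scale)
  define est where "est i = soft (real n * l / (hard_scale n i)\<^sup>2) (y i / hard_scale n i)" for i
  define err where "err i = (est i - (if i = 0 then 1 else 0))\<^sup>2" for i
  let ?S = "{i. i < n \<and> y i \<le> \<mu> $ i - 2}"
  have S: "finite ?S" "?S \<subseteq> {..<n}" by auto
  have "lasso (mat_diag n (hard_scale n)) (vec n y) l = vec n est"
    unfolding est_def using assms(1,2) r(1) q(1) by (intro lasso_mat_diag) (auto simp: scale)
  then have loss: "sq_l2_norm (lasso (mat_diag n (hard_scale n)) (vec n y) l - unit_vec n 0) = (\<Sum>i<n. err i)"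
    by (simp add: sq_l2_norm_def err_def)
  have z0: "y 0 / q \<le> 1 - 2 / q"
    using y0 \<mu>[of 0] assms(1) q(1) by (simp add: field_simps)
  have est0: "est 0 = soft (l * r) (y 0 / q)"
    using r q(2) by (simp add: est_def scale power2_eq_square mult.commute flip: r(2))
  show ?thesis
  proof (cases "l * r \<ge> 1")
    \<comment> \<open>Bias: the signal is set to zero, or estimated with the wrong sign.\<close>
    case True
    moreover have "0 \<le> 2 / q" using q(1) by simp
    ultimately have "est 0 \<le> 0"
      using z0 unfolding est0 soft_def by (smt (verit))
    then have "1\<^sup>2 \<le> (1 - est 0)\<^sup>2" by (intro power_mono) auto
    then have "1 \<le> err 0" by (simp add: err_def power2_commute)
    also have "err 0 \<le> (\<Sum>i<n. err i)"
      using assms(1) by (intro member_le_sum) (auto simp: err_def)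
    finally have "1 \<le> (\<Sum>i<n. err i)" .
    moreover have "card ?S \<le> n"
      using card_mono[OF _ S(2)] by simp
    ultimately show ?thesis
      unfolding loss using assms(1) by (simp add: divide_le_eq_1 order_trans[of _ 1])
  next
    \<comment> \<open>Noise: shrinking by less than \<open>1 / r\<close> leaves at least half of a deviation of \<open>2 / r\<close>.\<close>
    case False
    have "1 / real n \<le> err i" if i: "i \<in> ?S" for i
    proof -
      have "1 / r \<le> (if i = 0 then 1 else 0) - est i"
      proof (cases "i = 0")
        \<comment> \<open>Thresholding only pulls towards \<open>0\<close>, hence cannot repair an estimate below \<open>1\<close>.\<close>
        case True
        have "0 < l * r" using assms(2) r(1) by simp
        then have "est 0 \<le> max 0 (y 0 / q)"
           unfolding est0 by (auto simp: soft_def)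
        also have "\<dots> \<le> 1 - 1 / r"
        proof -
          have "1 / r \<le> 1 / q" "1 / r \<le> 1" "0 \<le> 1 / q"
            using \<open>q \<le> r\<close> q(1) r(1) by (auto simp: frac_le)
          moreover have "2 / q = 1 / q + 1 / q" by simp
          ultimately show ?thesis using z0 by linarith
        qed
        finally show ?thesis using True by simp
      next
        case False
        then have "est i = soft l (y i / r)"
          using r by (simp add: est_def scale power2_eq_square flip: r(2))
        moreover have "l < 1 / r" using \<open>\<not> l * r \<ge> 1\<close> r(1) by (simp add: field_simps)
        moreover have "y i / r \<le> - 2 * (1 / r)"
          using i False \<mu>[of i] r(1) by (simp add: field_simps)
        moreover have "0 < 1 / r" using r(1) by simp
        ultimately show ?thesis using False assms(2) unfolding soft_def by (smt (verit))
      qed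
      then have "(1 / r)\<^sup>2 \<le> ((if i = 0 then 1 else 0) - est i)\<^sup>2"
        using r(1) by (intro power_mono) auto
      moreover have "(1 / r)\<^sup>2 = 1 / real n"
        by (simp add: power_divide power2_eq_square r(2))
      ultimately show ?thesis
        unfolding err_def by (subst power2_commute) simp
    qed
    then have "(\<Sum>i\<in>?S. 1 / real n) \<le> (\<Sum>i\<in>?S. err i)" by (intro sum_mono)
    also have "\<dots> \<le> (\<Sum>i<n. err i)"
      using S by (intro sum_mono2) (auto simp: err_def)
    finally show ?thesis unfolding loss by simp
  qed
qed

text \<open>The fraction of coordinates with large negative noise is an average of indicators of
  measurable events; monotonicity of the Lebesgue integral transfers its expectation to the
  infimum over \<open>l\<close>.\<close>

lemma hard_instance_oracle_risk:
  assumes "n \<ge> 1"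
  shows "lasso_oracle_risk (mat_diag n (hard_scale n)) (unit_vec n 0) 1 \<ge> ennreal (gauss_tail\<^sup>2)"
proof -
  let ?X = "mat_diag n (hard_scale n)"
  define \<mu> where "\<mu> = ?X *\<^sub>v unit_vec n 0"
  have dim: "dim_vec \<mu> = n" "dim_row ?X = n" by (simp_all add: \<mu>_def mat_diag_def)
  define M where "M = normal_vec \<mu> 1"
  define A where "A i = {\<omega> \<in> space M. \<omega> 0 \<le> \<mu> $ 0 - 2 \<and> \<omega> i \<le> \<mu> $ i - 2}" for i
  have A: "A i \<in> sets M" "emeasure M (A i) \<ge> ennreal (gauss_tail\<^sup>2)" if "i < n" for i
    using normal_vec_joint_tail[of 0 \<mu> i] that assms dim unfolding A_def M_def by auto
  have "ennreal (gauss_tail\<^sup>2) = (\<Sum>i<n. ennreal (1 / real n) * ennreal (gauss_tail\<^sup>2))"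
    using assms gauss_tail_bounds by (simp add: ennreal_of_nat_eq_real_of_nat flip: ennreal_mult)
  also have "\<dots> \<le> (\<Sum>i<n. ennreal (1 / real n) * emeasure M (A i))"
    using A by (intro sum_mono mult_left_mono) auto
  also have "\<dots> = (\<integral>\<^sup>+\<omega>. (\<Sum>i<n. ennreal (1 / real n) * indicator (A i) \<omega>) \<partial>M)"
    using A by (subst nn_integral_sum) (auto simp: nn_integral_cmult_indicator)
  also have "\<dots> \<le> (\<integral>\<^sup>+\<omega>. (INF l\<in>{0<..}. ennreal (sq_l2_norm (lasso ?X (vec n \<omega>) l - unit_vec n 0))) \<partial>M)"
  proof (intro nn_integral_mono INF_greatest)
    fix \<omega> and l :: real assume \<omega>: "\<omega> \<in> space M" and l: "l \<in> {0<..}"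
    show "(\<Sum>i<n. ennreal (1 / real n) * indicator (A i) \<omega>)
        \<le> ennreal (sq_l2_norm (lasso ?X (vec n \<omega>) l - unit_vec n 0))"
    proof (cases "\<omega> 0 \<le> \<mu> $ 0 - 2")
      case True
      have "(\<Sum>i<n. ennreal (1 / real n) * indicator (A i) \<omega>)
          = (\<Sum>i<n. if \<omega> i \<le> \<mu> $ i - 2 then ennreal (1 / real n) else 0)"
        using True \<omega> by (intro sum.cong) (auto simp: A_def)
      also have "\<dots> = (\<Sum>i\<in>{i. i < n \<and> \<omega> i \<le> \<mu> $ i - 2}. ennreal (1 / real n))"
        by (subst sum.inter_filter[symmetric]) (auto intro!: sum.cong)
      also have "\<dots> = ennreal (real (card {i. i < n \<and> \<omega> i \<le> \<mu> $ i - 2}) / real n)"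
        by (simp add: ennreal_of_nat_eq_real_of_nat flip: ennreal_mult)
      also have "\<dots> \<le> ennreal (sq_l2_norm (lasso ?X (vec n \<omega>) l - unit_vec n 0))"
        using hard_instance_loss[OF assms, of l \<omega>] True l by (intro ennreal_leI) (auto simp: \<mu>_def)
      finally show ?thesis .
    qed (simp add: A_def)
  qed
  finally show ?thesis
    by (simp only: lasso_oracle_risk_def dim M_def \<mu>_def)
qed

theorem corollary1:
  shows "\<exists>c::real. c > 0 \<and>
    (\<forall>n d :: nat. \<forall>B :: real. n \<ge> 1 \<and> d = n \<and> B = sqrt (real n) \<longrightarrow>
       (\<forall>p \<sigma> R :: real. 0 < p \<and> p \<le> 1 \<and> \<sigma> = 1 \<and> R = 1 \<longrightarrow>
          (SUP X\<in>design_class n d B. SUP \<theta>\<in>p_ball d p R. lasso_oracle_risk X \<theta> \<sigma>) \<ge> ennreal c) \<and>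
       (\<forall>\<sigma> :: real. \<forall>s :: nat. \<sigma> = 1 \<and> s = 1 \<longrightarrow>
          (SUP X\<in>design_class n d B. SUP \<theta>\<in>l0_ball d s. lasso_oracle_risk X \<theta> \<sigma>) \<ge> ennreal c))"
proof -
  have bound: "ennreal (gauss_tail\<^sup>2) \<le> (SUP X\<in>design_class n n (sqrt (real n)). SUP \<theta>\<in>\<Theta>. lasso_oracle_risk X \<theta> 1)"
    if "n \<ge> 1" "unit_vec n 0 \<in> \<Theta>" for n \<Theta>
    using that by (intro SUP_upper2[OF hard_design_in_class] SUP_upper2[OF that(2)] hard_instance_oracle_risk)
  have "unit_vec n 0 \<in> p_ball n p 1" if "n \<ge> 1" "0 < p" for n p
  proof -
    have "(\<Sum>i<n. \<bar>unit_vec n 0 $ i\<bar> powr p) = (\<Sum>i<n. if i = 0 then 1 else 0 :: real)"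
      by (intro sum.cong) auto
    also have "\<dots> = 1" using that(1) by simp
    finally show ?thesis by (simp add: p_ball_def p_norm_def)
  qed
  moreover have "unit_vec n 0 \<in> l0_ball n 1" if "n \<ge> 1" for n
  proof -
    have "{i. i < n \<and> unit_vec n 0 $ i \<noteq> (0::real)} = {0}" using that by (auto split: if_splits)
    then show ?thesis by (simp add: l0_ball_def l0_norm_def)
  qed
  ultimately show ?thesis
    using gauss_tail_bounds by (intro exI[of _ "gauss_tail\<^sup>2"]) (auto intro!: bound)
qed

end
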